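(* Let $A$ be an abelian group which is not almost divisible. Then there exist a directed poset $\mathcal{T}$ with $|\mathcal{T}|=2^{\aleph_0}$ and a diagram $X:\mathcal{T}\to\mathbf{Set}_*$ all of whose structure maps are surjective (in particular $X$ satisfies the Mittag-Leffler condition) such that $H(X,A)$ is not cotorsion.
   Context: A directed poset is regarded as a category with a single morphism $t\to s$ whenever $t\ge s$. For a pointed set $Y$, $Y\wedge A:=\bigoplus_{Y\setminus\{*\}}A$ (finitely supported pointed maps $Y\to A$), functorial via $f_*(sv)=f(s)v$, where $sv$ is the element with value $v$ at $s$ ($*v=0$). $H(X,A):=\lim_\mathcal{T}(X\wedge A)/\mathrm{Im}\,\rho$, where $\rho:(\lim_\mathcal{T}X)\wedge A\to\lim_\mathcal{T}(X\wedge A)$, $\rho(xv)(t)=x(t)v$. An abelian group is almost divisible iff it is the direct sum of a divisible group and a bounded group. A group $C$ is cotorsion if $\mathrm{Ext}(\mathbb{Q},C)=0$. *)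

theory Defs
  imports "HOL-Algebra.Algebra" "HOL-Library.Equipollence"
begin

definition divisible_subgroup :: "('a,'m) monoid_scheme \<Rightarrow> 'a set \<Rightarrow> bool" where
  "divisible_subgroup A D \<longleftrightarrow> subgroup D A \<and>
     (\<forall>x\<in>D. \<forall>n::nat. n > 0 \<longrightarrow> (\<exists>y\<in>D. y [^]\<^bsub>A\<^esub> n = x))"

definition bounded_subgroup :: "('a,'m) monoid_scheme \<Rightarrow> 'a set \<Rightarrow> bool" where
  "bounded_subgroup A B \<longleftrightarrow> subgroup B A \<and>
     (\<exists>n::nat. n > 0 \<and> (\<forall>x\<in>B. x [^]\<^bsub>A\<^esub> n = \<one>\<^bsub>A\<^esub>))"

definition almost_divisible :: "('a,'m) monoid_scheme \<Rightarrow> bool" where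
  "almost_divisible A \<longleftrightarrow> (\<exists>D B. divisible_subgroup A D \<and> bounded_subgroup A B \<and>
      D \<inter> B = {\<one>\<^bsub>A\<^esub>} \<and> D <#>\<^bsub>A\<^esub> B = carrier A)"

definition Qgroup :: "rat monoid" where
  "Qgroup = \<lparr>carrier = UNIV, monoid.mult = (+), one = 0\<rparr>"

(* Ext(Q,C) = 0: every extension 0 -> C -> E -> Q -> 0 of abelian groups splits.
   Every such extension is (as a set) in bijection with carrier C \<times> Q, so it
   suffices to let E range over groups whose carrier lies in type 'c \<times> rat. *)
definition cotorsion :: "('c,'m) monoid_scheme \<Rightarrow> bool" where
  "cotorsion C \<longleftrightarrow> (\<forall>(E :: ('c \<times> rat) monoid) i p.
      comm_group E \<and> i \<in> hom C E \<and> inj_on i (carrier C) \<and>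
      p \<in> hom E Qgroup \<and> p ` carrier E = UNIV \<and> kernel E Qgroup p = i ` carrier C
      \<longrightarrow> (\<exists>s \<in> hom Qgroup E. \<forall>q. p (s q) = q))"

definition directed_poset :: "'i set \<Rightarrow> ('i \<Rightarrow> 'i \<Rightarrow> bool) \<Rightarrow> bool" where
  "directed_poset T leq \<longleftrightarrow> T \<noteq> {} \<and>
     (\<forall>t\<in>T. leq t t) \<and>
     (\<forall>s\<in>T. \<forall>t\<in>T. leq s t \<and> leq t s \<longrightarrow> s = t) \<and>
     (\<forall>r\<in>T. \<forall>s\<in>T. \<forall>t\<in>T. leq r s \<and> leq s t \<longrightarrow> leq r t) \<and>
     (\<forall>s\<in>T. \<forall>t\<in>T. \<exists>u\<in>T. leq s u \<and> leq t u)"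

definition pointed_diagram ::
  "'i set \<Rightarrow> ('i \<Rightarrow> 'i \<Rightarrow> bool) \<Rightarrow> ('i \<Rightarrow> 'x set) \<Rightarrow> ('i \<Rightarrow> 'x) \<Rightarrow> ('i \<Rightarrow> 'i \<Rightarrow> 'x \<Rightarrow> 'x) \<Rightarrow> bool" where
  "pointed_diagram T leq Xs bp F \<longleftrightarrow>
     (\<forall>t\<in>T. bp t \<in> Xs t) \<and>
     (\<forall>s\<in>T. \<forall>t\<in>T. leq s t \<longrightarrow> F t s \<in> Xs t \<rightarrow> Xs s \<and> F t s (bp t) = bp s) \<and>
     (\<forall>t\<in>T. \<forall>y\<in>Xs t. F t t y = y) \<and>
     (\<forall>r\<in>T. \<forall>s\<in>T. \<forall>t\<in>T. leq r s \<and> leq s t \<longrightarrow> (\<forall>y\<in>Xs t. F s r (F t s y) = F t r y))"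

definition surjective_diagram ::
  "'i set \<Rightarrow> ('i \<Rightarrow> 'i \<Rightarrow> bool) \<Rightarrow> ('i \<Rightarrow> 'x set) \<Rightarrow> ('i \<Rightarrow> 'i \<Rightarrow> 'x \<Rightarrow> 'x) \<Rightarrow> bool" where
  "surjective_diagram T leq Xs F \<longleftrightarrow> (\<forall>s\<in>T. \<forall>t\<in>T. leq s t \<longrightarrow> F t s ` Xs t = Xs s)"

definition lim_set ::
  "'i set \<Rightarrow> ('i \<Rightarrow> 'i \<Rightarrow> bool) \<Rightarrow> ('i \<Rightarrow> 'x set) \<Rightarrow> ('i \<Rightarrow> 'i \<Rightarrow> 'x \<Rightarrow> 'x) \<Rightarrow> ('i \<Rightarrow> 'x) set" where
  "lim_set T leq Xs F = {x \<in> Pi\<^sub>E T Xs. \<forall>s\<in>T. \<forall>t\<in>T. leq s t \<longrightarrow> F t s (x t) = x s}"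

(* Y \<and> A for a pointed set (Y, b): finitely supported maps Y -> A vanishing at b
   (represented as functions that are 1 outside Y - {b}) *)
definition smash :: "'x set \<Rightarrow> 'x \<Rightarrow> ('a,'m) monoid_scheme \<Rightarrow> ('x \<Rightarrow> 'a) set" where
  "smash Y b A = {u. (\<forall>y. u y \<in> carrier A) \<and> (\<forall>y. y \<notin> Y - {b} \<longrightarrow> u y = \<one>\<^bsub>A\<^esub>)
                     \<and> finite {y. u y \<noteq> \<one>\<^bsub>A\<^esub>}}"

(* f_* : Y \<and> A -> Z \<and> A for a pointed map f : (Y,b) -> (Z,b'), f_*(s v) = f(s) v, * v = 0 *)
definition smash_map :: "('a,'m) monoid_scheme \<Rightarrow> ('x \<Rightarrow> 'y) \<Rightarrow> 'y \<Rightarrow> ('x \<Rightarrow> 'a) \<Rightarrow> ('y \<Rightarrow> 'a)" where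
  "smash_map A f b' u = (\<lambda>z. if z = b' then \<one>\<^bsub>A\<^esub>
                              else finprod A u {y. u y \<noteq> \<one>\<^bsub>A\<^esub> \<and> f y = z})"

definition lim_smash_group ::
  "('a,'m) monoid_scheme \<Rightarrow> 'i set \<Rightarrow> ('i \<Rightarrow> 'i \<Rightarrow> bool) \<Rightarrow> ('i \<Rightarrow> 'x set) \<Rightarrow> ('i \<Rightarrow> 'x)
    \<Rightarrow> ('i \<Rightarrow> 'i \<Rightarrow> 'x \<Rightarrow> 'x) \<Rightarrow> ('i \<Rightarrow> 'x \<Rightarrow> 'a) monoid" where
  "lim_smash_group A T leq Xs bp F =
     \<lparr>carrier = {w \<in> Pi\<^sub>E T (\<lambda>t. smash (Xs t) (bp t) A).
                  \<forall>s\<in>T. \<forall>t\<in>T. leq s t \<longrightarrow> smash_map A (F t s) (bp s) (w t) = w s},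
      monoid.mult = (\<lambda>w w'. \<lambda>t\<in>T. \<lambda>y. w t y \<otimes>\<^bsub>A\<^esub> w' t y),
      one = (\<lambda>t\<in>T. \<lambda>y. \<one>\<^bsub>A\<^esub>)\<rparr>"

(* image of rho : (lim_T X) \<and> A -> lim_T (X \<and> A),  rho(x v)(t) = x(t) v *)
definition rho_image ::
  "('a,'m) monoid_scheme \<Rightarrow> 'i set \<Rightarrow> ('i \<Rightarrow> 'i \<Rightarrow> bool) \<Rightarrow> ('i \<Rightarrow> 'x set) \<Rightarrow> ('i \<Rightarrow> 'x)
    \<Rightarrow> ('i \<Rightarrow> 'i \<Rightarrow> 'x \<Rightarrow> 'x) \<Rightarrow> ('i \<Rightarrow> 'x \<Rightarrow> 'a) set" where
  "rho_image A T leq Xs bp F =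
     (\<lambda>u. \<lambda>t\<in>T. smash_map A (\<lambda>x. x t) (bp t) u)
       ` smash (lim_set T leq Xs F) (\<lambda>t\<in>T. bp t) A"

definition H_group ::
  "('a,'m) monoid_scheme \<Rightarrow> 'i set \<Rightarrow> ('i \<Rightarrow> 'i \<Rightarrow> bool) \<Rightarrow> ('i \<Rightarrow> 'x set) \<Rightarrow> ('i \<Rightarrow> 'x)
    \<Rightarrow> ('i \<Rightarrow> 'i \<Rightarrow> 'x \<Rightarrow> 'x) \<Rightarrow> ('i \<Rightarrow> 'x \<Rightarrow> 'a) set monoid" where
  "H_group A T leq Xs bp F = lim_smash_group A T leq Xs bp F Mod rho_image A T leq Xs bp F"

end

(* Index by the sets S of pairs (i, j) all of whose rows are finite, ordered by inclusion, and let X S be S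
   with a base point added, pairs outside the smaller set being collapsed. Then lim (X smash A) consists of the
   families (a i j) with only finitely many nonzero rows, and Im rho of the finitely supported ones, so
   H(X, A) is a direct sum of countably many copies of B = A^N / A^(N).

   If C is cotorsion, the recurrence h n + c n = (n+2) h (n+1) is solvable in C for every sequence c: split the
   extension of the rationals in which the c n are the obstructions to divisibility. Take c i to be constantly
   a i in row i and zero elsewhere. Some row i of a representative of h 0 vanishes, and reading the recurrence
   there, at a column missed by the relevant correction terms from Im rho, makes (i+1)! a i divisible by (N+1)!
   for every N. Yet if A is not almost divisible, no (i+1)! A is divisible (divisible subgroups are direct
   summands), so a i can be chosen to prevent this. *)
theory Submission
  imports Defs
begin

section \<open>Divisible subgroups split off\<close>

lemma set_mult_memI: "h \<in> H \<Longrightarrow> k \<in> K \<Longrightarrow> h \<otimes>\<^bsub>G\<^esub> k \<in> H <#>\<^bsub>G\<^esub> K"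
  by (auto simp: set_mult_def)

text \<open>Zorn gives a \<open>B\<close> maximal among the subgroups meeting \<open>D\<close>
  trivially. If \<open>D <#> B\<close> were not everything, divisibility of \<open>D\<close> would
  produce a larger such subgroup.\<close>

lemma (in comm_group) divisible_subgroup_complement:
  assumes "divisible_subgroup G D"
  obtains B where "subgroup B G" "D \<inter> B = {\<one>}" "D <#> B = carrier G"
proof -
  have D: "subgroup D G"
    and div: "\<And>x n. x \<in> D \<Longrightarrow> n > 0 \<Longrightarrow> \<exists>y\<in>D. y [^] (n::nat) = x"
    using assms by (auto simp: divisible_subgroup_def)
  interpret D: subgroup D G by fact
  define S where "S = {B. subgroup B G \<and> D \<inter> B = {\<one>}}"
  have "{\<one>} \<in> S"
    using triv_subgroup by (auto simp: S_def)
  moreover have "\<Union>\<C> \<in> S" if ne: "\<C> \<noteq> {}" and ch: "subset.chain S \<C>" for \<C>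
  proof -
    have sub: "\<And>Z'. Z' \<in> \<C> \<Longrightarrow> subgroup Z' G \<and> D \<inter> Z' = {\<one>}"
      using ch by (auto simp: subset.chain_def S_def)
    have "subgroup (\<Union>\<C>) G"
    proof (rule subgroupI)
      show "\<Union>\<C> \<subseteq> carrier G" using sub subgroup.subset by blast
      show "\<Union>\<C> \<noteq> {}" using sub ne by blast
      show "inv a \<in> \<Union>\<C>" if "a \<in> \<Union>\<C>" for a
        using sub that by (metis UnionE UnionI subgroup.m_inv_closed)
      show "a \<otimes> b \<in> \<Union>\<C>" if "a \<in> \<Union>\<C>" "b \<in> \<Union>\<C>" for a b
      proof -
        obtain Z' Y where XY: "Z' \<in> \<C>" "a \<in> Z'" "Y \<in> \<C>" "b \<in> Y" using \<open>a \<in> _\<close> \<open>b \<in> _\<close> by blast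
        then have "Z' \<subseteq> Y \<or> Y \<subseteq> Z'"
          using ch by (auto simp: subset_chain_def)
        then obtain Z where "Z \<in> \<C>" "a \<in> Z" "b \<in> Z" using XY by blast
        then show ?thesis using sub by (metis UnionI subgroup.m_closed)
      qed
    qed
    moreover have "D \<inter> \<Union>\<C> = {\<one>}" using sub ne by blast
    ultimately show ?thesis by (simp add: S_def)
  qed
  ultimately obtain B where "B \<in> S" and max: "\<And>Z'. Z' \<in> S \<Longrightarrow> B \<subseteq> Z' \<Longrightarrow> Z' = B"
    using subset_Zorn_nonempty[of S] by (metis empty_iff)
  then have B: "subgroup B G" and DB1: "D \<inter> B = {\<one>}" by (auto simp: S_def)
  interpret B: subgroup B G by fact
  let ?DB = "D <#> B"
  have DB: "subgroup ?DB G" using mult_subgroups D B .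
  interpret DB: subgroup ?DB G by fact
  have DsubDB: "d \<in> ?DB" if "d \<in> D" for d
    using set_mult_memI[OF that B.one_closed, of G] that D.mem_carrier by simp
  have BsubDB: "b \<in> ?DB" if "b \<in> B" for b
    using set_mult_memI[OF D.one_closed that, of G] that B.mem_carrier by simp
  have "?DB = carrier G"
  proof (rule ccontr)
    assume "?DB \<noteq> carrier G"
    then obtain x where x: "x \<in> carrier G" "x \<notin> ?DB" using DB.subset by blast
    \<comment> \<open>The property sought: a power of \<open>y\<close> that lies in
      \<open>D <#> B\<close> already lies in \<open>B\<close>, so adjoining \<open>y\<close> to
      \<open>B\<close> creates no new intersection with \<open>D\<close>.\<close>
    obtain y where y: "y \<in> carrier G" "y \<notin> ?DB"
      and yB: "\<And>m::int. y [^] m \<in> ?DB \<Longrightarrow> y [^] m \<in> B"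
    proof (cases "\<exists>k::nat. k > 0 \<and> x [^] k \<in> ?DB")
      case False
      \<comment> \<open>Here \<open>x\<close> has infinite order modulo \<open>D <#> B\<close>, so
        \<open>y = x\<close> works: the only power to check is the trivial one.\<close>
      have "m = 0" if "x [^] m \<in> ?DB" for m :: int
      proof (rule ccontr)
        assume "m \<noteq> 0"
        then consider "m > 0" | "m < 0" by linarith
        then show False
        proof cases
          case 1
          with False that show False
            by (metis int_pow_int pos_int_cases)
        next
          case 2
          then have "x [^] (- m) \<in> ?DB" using that x by (simp add: int_pow_neg)
          with False 2 show False
            by (metis int_pow_int neg_0_less_iff_less pos_int_cases)
        qed
      qed
      then show ?thesis using that[of x] x B.one_closed by fastforce
    next
      case True
      define k where "k = (LEAST k::nat. k > 0 \<and> x [^] k \<in> ?DB)"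
      have k: "k > 0" "x [^] k \<in> ?DB"
        using LeastI_ex[OF True] by (auto simp: k_def)
      have kmin: "x [^] r \<notin> ?DB" if "0 < r" "r < k" for r
        using not_less_Least[of r "\<lambda>k. k > 0 \<and> x [^] k \<in> ?DB"] that by (auto simp: k_def)
      obtain d b where db: "d \<in> D" "b \<in> B" "x [^] k = d \<otimes> b"
        using k(2) by (auto simp: set_mult_def)
      \<comment> \<open>This is where divisibility enters: the \<open>D\<close>-part of
        \<open>x [^] k\<close> has a \<open>k\<close>-th root in \<open>D\<close>, and dividing
        \<open>x\<close> by it gives a \<open>y\<close> with \<open>y [^] k\<close> in
        \<open>B\<close>.\<close>
      obtain d' where d': "d' \<in> D" "d' [^] k = d" using div[OF db(1) k(1)] by blast
      have dc: "d' \<in> carrier G" "d \<in> carrier G" "b \<in> carrier G"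
        using d' db D.mem_carrier B.mem_carrier by auto
      define y where "y = inv d' \<otimes> x"
      have yc: "y \<in> carrier G" using dc x by (simp add: y_def)
      have xy: "x = d' \<otimes> y" using dc x by (simp add: y_def m_assoc[symmetric])
      have yk: "y [^] k = b"
        using dc x db(3) d'(2) by (simp add: y_def nat_pow_distrib nat_pow_inv m_assoc[symmetric])
      \<comment> \<open>\<open>x\<close> and \<open>y\<close> differ by an element of
        \<open>D\<close>, so \<open>y\<close> has the same order \<open>k\<close> modulo
        \<open>D <#> B\<close>.\<close>
      have ymin: "y [^] r \<notin> ?DB" if "0 < r" "r < k" for r :: nat
      proof
        assume "y [^] r \<in> ?DB"
        moreover have "d' [^] r \<in> ?DB" using subgroup_int_pow_closed[OF DB DsubDB[OF d'(1)], of "int r"] by (simp add: int_pow_int)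
        ultimately have "d' [^] r \<otimes> y [^] r \<in> ?DB" by simp
        then show False using kmin[OF that] dc yc xy by (simp add: nat_pow_distrib)
      qed
      have "y [^] m \<in> B" if m: "y [^] m \<in> ?DB" for m :: int
      proof -
        \<comment> \<open>Division with remainder: \<open>y [^] (k * q)\<close> is a power of
          \<open>b\<close>, and minimality of \<open>k\<close> forces the remainder to be
          \<open>0\<close>.\<close>
        define q where "q = m div int k"
        define r where "r = m mod int k"
        have mqr: "m = int k * q + r" by (simp add: q_def r_def)
        have bq: "y [^] (int k * q) = b [^] q"
          using yc yk by (simp add: int_pow_pow[symmetric] int_pow_int)
        have bqB: "b [^] q \<in> B" using B db(2) by (rule subgroup_int_pow_closed)
        have "y [^] r = inv (b [^] q) \<otimes> y [^] m"
          using yc dc by (simp add: mqr int_pow_mult bq m_assoc[symmetric])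
        then have "y [^] r \<in> ?DB" using m bqB BsubDB by simp
        then have "r = 0"
          using ymin[of "nat r"] k(1) pos_mod_bound[of "int k" m] pos_mod_sign[of "int k" m]
          by (metis int_pow_int int_nat_eq nat_0_iff nat_less_iff not_gr_zero of_nat_0_less_iff order_antisym r_def)
        then show ?thesis using bqB bq mqr by simp
      qed
      moreover have "y \<notin> ?DB" using xy x(2) DsubDB[OF d'(1)] DB.m_closed by blast
      ultimately show ?thesis using that yc by blast
    qed
    define B' where "B' = B <#> generate G {y}"
    have gen: "generate G {y} = {y [^] m |m::int. True}"
      using generate_pow[OF y(1)] by auto
    have sg: "subgroup (generate G {y}) G" using generate_is_subgroup y by simp
    have "B' \<in> S"
    proof -
      have "D \<inter> B' \<subseteq> {\<one>}"
      proof
        fix z assume z: "z \<in> D \<inter> B'"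
        then obtain b m where b: "b \<in> B" and zb: "z = b \<otimes> y [^] (m::int)"
          by (auto simp: B'_def set_mult_def gen)
        have "y [^] m = inv b \<otimes> z"
          using zb b B.mem_carrier y by (simp add: m_assoc[symmetric])
        then have "y [^] m \<in> ?DB" using z b BsubDB DsubDB by simp
        then have "y [^] m \<in> B" by (rule yB)
        then have "z \<in> B" using b zb by simp
        then show "z \<in> {\<one>}" using z DB1 by blast
      qed
      moreover have "subgroup B' G" unfolding B'_def using mult_subgroups B sg .
      ultimately show ?thesis using D.one_closed subgroup.one_closed unfolding S_def by blast
    qed
    moreover have "B \<subseteq> B'"
    proof
      fix b assume b: "b \<in> B"
      then have "b \<otimes> \<one> \<in> B'"
        unfolding B'_def using subgroup.one_closed[OF sg] by (rule set_mult_memI)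
      then show "b \<in> B'" using b B.mem_carrier by simp
    qed
    ultimately have "B' = B" by (rule max)
    moreover have "\<one> \<otimes> y \<in> B'"
      unfolding B'_def by (intro set_mult_memI B.one_closed generate.incl) simp
    then have "y \<in> B'" using y by simp
    ultimately show False using y BsubDB by blast
  qed
  then show ?thesis using that B DB1 by blast
qed

text \<open>Additively, \<open>n m y = n x\<close> exhibits \<open>n x\<close> as \<open>m\<close>
  times an element of \<open>n G\<close>, so \<open>n G\<close> is divisible and splits off. A
  complement \<open>B\<close> is bounded, since \<open>n B\<close> lies both in \<open>B\<close> and
  in \<open>n G\<close>.\<close>

lemma (in comm_group) almost_divisible_if_multiples_divisible:
  fixes n :: nat
  assumes n: "n > 0"
    and div: "\<And>x m::nat. x \<in> carrier G \<Longrightarrow> m > 0 \<Longrightarrow> \<exists>y\<in>carrier G. y [^] (n * m) = x [^] n"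
  shows "almost_divisible G"
proof -
  define D where "D = (\<lambda>x. x [^] n) ` carrier G"
  have "subgroup D G"
  proof (rule subgroupI)
    fix a b assume "a \<in> D" "b \<in> D"
    then obtain x y where "x \<in> carrier G" "y \<in> carrier G" "a = x [^] n" "b = y [^] n"
      by (auto simp: D_def)
    then have "a \<otimes> b = (x \<otimes> y) [^] n" "x \<otimes> y \<in> carrier G" by (simp_all add: nat_pow_distrib)
    then show "a \<otimes> b \<in> D" unfolding D_def by blast
  next
    fix a assume "a \<in> D"
    then obtain x where "x \<in> carrier G" "a = x [^] n" by (auto simp: D_def)
    then have "inv a = (inv x) [^] n" "inv x \<in> carrier G" by (simp_all add: nat_pow_inv)
    then show "inv a \<in> D" unfolding D_def by blast
  qed (auto simp: D_def)
  moreover have "\<exists>z\<in>D. z [^] m = x" if "x \<in> D" "m > 0" for x and m :: nat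
  proof -
    obtain y where "y \<in> carrier G" "x = y [^] n" using \<open>x \<in> D\<close> by (auto simp: D_def)
    then show ?thesis using div[of y m] \<open>m > 0\<close> nat_pow_pow by (auto simp: D_def)
  qed
  ultimately have D: "divisible_subgroup G D" by (simp add: divisible_subgroup_def)
  then obtain B where B: "subgroup B G" "D \<inter> B = {\<one>}" "D <#> B = carrier G"
    by (rule divisible_subgroup_complement)
  have "x [^] n = \<one>" if "x \<in> B" for x
  proof -
    have "x [^] n \<in> D" using that subgroup.mem_carrier[OF B(1)] by (auto simp: D_def)
    moreover have "x [^] n \<in> B" using B(1) that by (metis subgroup_int_pow_closed int_pow_int)
    ultimately show ?thesis using B(2) by blast
  qed
  then show ?thesis using D B n by (auto simp: almost_divisible_def bounded_subgroup_def)
qed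

section \<open>Cotorsion groups solve factorial recurrences\<close>

declare fact_Suc [simp del]

text \<open>The partial sum over \<open>k < n\<close> of the formal series
  \<open>\<Sum>k. \<lfloor>q (k+1)!\<rfloor> c k\<close>, in multiplicative notation.\<close>

definition floor_prod :: "('c,'m) monoid_scheme \<Rightarrow> (nat \<Rightarrow> 'c) \<Rightarrow> nat \<Rightarrow> rat \<Rightarrow> 'c" where
  "floor_prod C c n q = (\<Otimes>\<^bsub>C\<^esub>k\<in>{..<n}. c k [^]\<^bsub>C\<^esub> \<lfloor>q * fact (Suc k)\<rfloor>)"

text \<open>The coboundary of \<open>floor_prod\<close>: the failure of the partial sums to be
  additive in \<open>q\<close>. The partial sums need not stabilise as \<open>n\<close> grows, but
  this defect does.\<close>

definition floor_cocycle :: "('c,'m) monoid_scheme \<Rightarrow> (nat \<Rightarrow> 'c) \<Rightarrow> nat \<Rightarrow> rat \<Rightarrow> rat \<Rightarrow> 'c" where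
  "floor_cocycle C c n q r =
     floor_prod C c n q \<otimes>\<^bsub>C\<^esub> floor_prod C c n r \<otimes>\<^bsub>C\<^esub> inv\<^bsub>C\<^esub> floor_prod C c n (q + r)"

lemma rat_mult_fact_Ints_mono:
  fixes q :: rat
  assumes "q * fact m \<in> \<int>" "m \<le> n"
  shows "q * fact n \<in> \<int>"
proof -
  obtain k :: nat where "fact n = fact m * k" using fact_dvd[OF assms(2), where 'a=nat] by (auto elim: dvdE)
  then have "(fact n :: rat) = fact m * of_nat k" by (metis of_nat_fact of_nat_mult)
  then have "q * fact n = (q * fact m) * of_nat k" by simp
  then show ?thesis using assms(1) by (metis Ints_mult Ints_of_nat)
qed

text \<open>Every denominator divides a factorial, namely its own.\<close>

lemma rat_mult_fact_Ints:
  fixes q :: rat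
  obtains n where "q * fact (Suc n) \<in> \<int>"
proof -
  obtain a b where ab: "q = of_int a / of_int b" "b > 0" by (metis quotient_of_div surjective_pairing quotient_of_denom_pos)
  have "nat b dvd fact (nat b)" using ab by (intro dvd_fact) auto
  then obtain k where "fact (nat b) = nat b * k" by (auto elim: dvdE)
  then have "(fact (nat b) :: rat) = of_int b * of_nat k" using ab(2)
    by (metis of_nat_fact of_nat_mult of_nat_nat less_imp_le)
  then have "q * fact (nat b) = of_int a * of_nat k" using ab by simp
  then show ?thesis using rat_mult_fact_Ints_mono[of q "nat b" "Suc (nat b)"] that[of "nat b"]
    by (metis Ints_mult Ints_of_nat Ints_of_int le_SucI order_refl)
qed

context comm_group
begin

lemma floor_prod_closed [simp]:
  "(\<And>n. c n \<in> carrier G) \<Longrightarrow> floor_prod G c n q \<in> carrier G"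
  by (simp add: floor_prod_def)

lemma floor_cocycle_closed [simp]:
  "(\<And>n. c n \<in> carrier G) \<Longrightarrow> floor_cocycle G c n q r \<in> carrier G"
  by (simp add: floor_cocycle_def)

lemma floor_prod_Suc:
  "(\<And>n. c n \<in> carrier G) \<Longrightarrow>
    floor_prod G c (Suc n) q = c n [^] \<lfloor>q * fact (Suc n)\<rfloor> \<otimes> floor_prod G c n q"
  unfolding floor_prod_def lessThan_Suc by (subst finprod_insert) auto

lemma floor_prod_eq_one:
  assumes c: "\<And>n. c n \<in> carrier G" and "0 \<le> q" "q * fact n < 1"
  shows "floor_prod G c n q = \<one>"
proof -
  have "\<lfloor>q * fact (Suc k)\<rfloor> = 0" if "k < n" for k
  proof -
    have "(fact (Suc k) :: rat) \<le> fact n" using that by (intro fact_mono) auto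
    then have "q * fact (Suc k) \<le> q * fact n" using assms(2) by (rule mult_left_mono)
    then have "q * fact (Suc k) < 1" using assms(3) by simp
    moreover have "0 \<le> q * fact (Suc k)" using assms(2) by simp
    ultimately show ?thesis by (simp add: floor_eq_iff)
  qed
  then show ?thesis unfolding floor_prod_def
    by (intro finprod_one_eqI) simp
qed

text \<open>Once \<open>q (n+1)!\<close> and \<open>r (n+1)!\<close> are integers, the floors in
  term \<open>n\<close> are exact and additive, so the powers of \<open>c n\<close> cancel in the
  cocycle.\<close>

lemma floor_cocycle_stable:
  assumes c: "\<And>n. c n \<in> carrier G"
    and q: "q * fact (Suc m) \<in> \<int>" and r: "r * fact (Suc m) \<in> \<int>" and "m \<le> n"
  shows "floor_cocycle G c n q r = floor_cocycle G c m q r"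
  using \<open>m \<le> n\<close>
proof (induction rule: dec_induct)
  case (step n)
  have "q * fact (Suc n) \<in> \<int>" "r * fact (Suc n) \<in> \<int>"
    using rat_mult_fact_Ints_mono[OF q, of "Suc n"] rat_mult_fact_Ints_mono[OF r, of "Suc n"] step by auto
  then obtain x y where x: "q * fact (Suc n) = of_int x" and y: "r * fact (Suc n) = of_int y"
    by (auto elim!: Ints_cases)
  have xy: "(q + r) * fact (Suc n) = of_int (x + y)"
    unfolding distrib_right x y by simp
  let ?F = "floor_prod G c n"
  have "floor_cocycle G c (Suc n) q r =
    (c n [^] x \<otimes> ?F q) \<otimes> (c n [^] y \<otimes> ?F r) \<otimes> inv (c n [^] (x + y) \<otimes> ?F (q + r))"
    unfolding floor_cocycle_def floor_prod_Suc[OF c] x y xy floor_of_int ..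
  also have "\<dots> = (c n [^] (x + y) \<otimes> inv (c n [^] (x + y))) \<otimes> floor_cocycle G c n q r"
    using c by (simp add: floor_cocycle_def int_pow_mult inv_mult m_ac del: r_inv Units_r_inv)
  also have "\<dots> = floor_cocycle G c n q r" using c by simp
  finally show ?case using step by simp
qed simp

end

text \<open>The extension of \<open>\<rat>\<close> by \<open>C\<close> generated by \<open>C\<close> and elements \<open>e n\<close> over \<open>1/(n+1)!\<close> with
  \<open>e n = c n + (n+2) e (n+1)\<close>. Formally, \<open>(x, q)\<close> stands for \<open>x + (\<Sum>k. \<lfloor>q (k+1)!\<rfloor> c k)\<close>; since almost
  all \<open>q (k+1)!\<close> are integers, only finitely many terms of the infinite sums survive in the cocycle.\<close>

definition floor_extension :: "('c,'m) monoid_scheme \<Rightarrow> (nat \<Rightarrow> 'c) \<Rightarrow> ('c \<times> rat) monoid" where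
  "floor_extension C c = \<lparr>carrier = carrier C \<times> UNIV,
     monoid.mult = (\<lambda>(x, q) (y, r). (x \<otimes>\<^bsub>C\<^esub> y \<otimes>\<^bsub>C\<^esub>
        floor_cocycle C c (LEAST m. q * fact (Suc m) \<in> \<int> \<and> r * fact (Suc m) \<in> \<int>) q r, q + r)),
     one = (\<one>\<^bsub>C\<^esub>, 0)\<rparr>"

section \<open>The extension of the rationals and its splitting\<close>

context comm_group
begin

text \<open>Frees the product from \<open>LEAST\<close>: every level that clears both denominators
  computes the same cocycle, so a calculation can use one common level for all rationals
  involved.\<close>

lemma floor_extension_mult:
  assumes c: "\<And>n. c n \<in> carrier G" and q: "q * fact (Suc m) \<in> \<int>" and r: "r * fact (Suc m) \<in> \<int>"
  shows "(x, q) \<otimes>\<^bsub>floor_extension G c\<^esub> (y, r) = (x \<otimes> y \<otimes> floor_cocycle G c m q r, q + r)"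
proof -
  let ?P = "\<lambda>m. q * fact (Suc m) \<in> \<int> \<and> r * fact (Suc m) \<in> \<int>"
  have "?P (LEAST m. ?P m)" by (rule LeastI[of ?P m]) (use q r in simp)
  moreover have "(LEAST m. ?P m) \<le> m" by (rule Least_le) (use q r in simp)
  ultimately have "floor_cocycle G c m q r = floor_cocycle G c (LEAST m. ?P m) q r"
    by (intro floor_cocycle_stable[OF c]) auto
  then show ?thesis by (simp add: floor_extension_def)
qed

lemma comm_group_floor_extension:
  assumes c: "\<And>n. c n \<in> carrier G"
  shows "comm_group (floor_extension G c)"
proof (rule comm_groupI)
  let ?E = "floor_extension G c"
  have level: "\<exists>m. q * fact (Suc m) \<in> \<int> \<and> r * fact (Suc m) \<in> \<int> \<and> s * fact (Suc m) \<in> \<int>" for q r s :: rat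
  proof -
    obtain a b d where "q * fact (Suc a) \<in> \<int>" "r * fact (Suc b) \<in> \<int>" "s * fact (Suc d) \<in> \<int>"
      using rat_mult_fact_Ints by metis
    then show ?thesis
      by (intro exI[of _ "a + b + d"]) (auto intro: rat_mult_fact_Ints_mono)
  qed
  have C: "carrier ?E = carrier G \<times> UNIV" by (simp add: floor_extension_def)
  fix x y z
  assume "x \<in> carrier ?E" "y \<in> carrier ?E" "z \<in> carrier ?E"
  then obtain a q b r d s where xyz: "x = (a, q)" "y = (b, r)" "z = (d, s)"
    and carr: "a \<in> carrier G" "b \<in> carrier G" "d \<in> carrier G"
    unfolding C by auto
  obtain m where m: "q * fact (Suc m) \<in> \<int>" "r * fact (Suc m) \<in> \<int>" "s * fact (Suc m) \<in> \<int>"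
    using level by blast
  have m': "(q + r) * fact (Suc m) \<in> \<int>" "(r + s) * fact (Suc m) \<in> \<int>" "(r + q) * fact (Suc m) \<in> \<int>"
    using m by (simp_all add: distrib_right)
  \<comment> \<open>At a common level the cocycle is the coboundary of \<open>?F\<close>. Both
    bracketings reduce to the values at \<open>q\<close>, \<open>r\<close>, \<open>s\<close> and
    \<open>q + r + s\<close>, while the intermediate value at \<open>q + r\<close> or
    \<open>r + s\<close> cancels.\<close>
  let ?F = "floor_prod G c m"
  have ext: "?F (q + r) \<otimes> inv ?F (q + r) = \<one>" "?F (r + s) \<otimes> inv ?F (r + s) = \<one>" using c by simp_all
  have "a \<otimes> b \<otimes> floor_cocycle G c m q r \<otimes> d \<otimes> floor_cocycle G c m (q + r) s
     = (a \<otimes> b \<otimes> d) \<otimes> (?F q \<otimes> ?F r \<otimes> ?F s \<otimes> inv ?F (q + r + s)) \<otimes> (?F (q + r) \<otimes> inv ?F (q + r))"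
    unfolding floor_cocycle_def using c carr by (simp add: m_ac del: r_inv Units_r_inv)
  also have "\<dots> = (a \<otimes> b \<otimes> d) \<otimes> (?F q \<otimes> ?F r \<otimes> ?F s \<otimes> inv ?F (q + (r + s))) \<otimes> (?F (r + s) \<otimes> inv ?F (r + s))"
    unfolding ext add.assoc ..
  also have "\<dots> = a \<otimes> (b \<otimes> d \<otimes> floor_cocycle G c m r s) \<otimes> floor_cocycle G c m q (r + s)"
    unfolding floor_cocycle_def using c carr by (simp add: m_ac del: r_inv Units_r_inv)
  finally show "x \<otimes>\<^bsub>?E\<^esub> y \<otimes>\<^bsub>?E\<^esub> z = x \<otimes>\<^bsub>?E\<^esub> (y \<otimes>\<^bsub>?E\<^esub> z)"
    by (simp add: xyz floor_extension_mult[OF c, where m=m] m m' add.assoc)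
next
  let ?E = "floor_extension G c"
  have C: "carrier ?E = carrier G \<times> UNIV" and one: "\<one>\<^bsub>?E\<^esub> = (\<one>, 0)"
    by (auto simp: floor_extension_def)
  show "\<one>\<^bsub>?E\<^esub> \<in> carrier ?E" by (simp add: C one)
  fix x
  assume "x \<in> carrier ?E"
  then obtain a q where x: "x = (a, q)" and a: "a \<in> carrier G" unfolding C by auto
  obtain m where m: "q * fact (Suc m) \<in> \<int>" using rat_mult_fact_Ints by blast
  have F0: "floor_prod G c m 0 = \<one>" using c by (simp add: floor_prod_eq_one)
  then show "\<one>\<^bsub>?E\<^esub> \<otimes>\<^bsub>?E\<^esub> x = x"
    using m a c by (simp add: x one floor_extension_mult[OF c, where m=m] floor_cocycle_def)
  \<comment> \<open>Inverting \<open>a\<close> alone is not enough: the cocycle of \<open>-q\<close>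
    and \<open>q\<close> has to be cancelled too.\<close>
  let ?f = "floor_cocycle G c m (-q) q"
  have "(inv a \<otimes> inv ?f, -q) \<otimes>\<^bsub>?E\<^esub> x = (inv a \<otimes> inv ?f \<otimes> a \<otimes> ?f, 0)"
    using m by (simp add: x floor_extension_mult[OF c, where m=m])
  also have "inv a \<otimes> inv ?f \<otimes> a \<otimes> ?f = (inv a \<otimes> a) \<otimes> (inv ?f \<otimes> ?f)"
    using a floor_cocycle_closed[of c, OF c] by (simp add: m_ac del: l_inv Units_l_inv)
  also have "\<dots> = \<one>" using a floor_cocycle_closed[of c, OF c] by simp
  finally show "\<exists>y\<in>carrier ?E. y \<otimes>\<^bsub>?E\<^esub> x = \<one>\<^bsub>?E\<^esub>"
    using a c by (intro bexI[of _ "(inv a \<otimes> inv ?f, -q)"]) (simp_all add: one C)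
next
  let ?E = "floor_extension G c"
  fix x y
  assume xy: "x \<in> carrier ?E" "y \<in> carrier ?E"
  then show "x \<otimes>\<^bsub>?E\<^esub> y \<in> carrier ?E"
    using c by (auto simp: floor_extension_def)
  show "x \<otimes>\<^bsub>?E\<^esub> y = y \<otimes>\<^bsub>?E\<^esub> x"
    using xy c by (auto simp: floor_extension_def floor_cocycle_def m_ac add.commute conj_commute)
qed

text \<open>A splitting of \<open>floor_extension\<close> lifts each \<open>1/(n+1)!\<close>, and
  the first component of the lift is \<open>h n\<close>. That \<open>1/(n+1)!\<close> is
  \<open>n+2\<close> times \<open>1/(n+2)!\<close> becomes the recurrence, with \<open>c n\<close>
  coming from the cocycle.\<close>

lemma cotorsion_imp_solvable_recurrence:
  assumes "cotorsion G" and c: "\<And>n. c n \<in> carrier G"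
  obtains h where "\<And>n. h n \<in> carrier G" "\<And>n. h n \<otimes> c n = h (Suc n) [^] (n + 2)"
proof -
  let ?E = "floor_extension G c"
  have "(\<lambda>x. (x, 0)) \<in> hom G ?E"
  proof (rule homI)
    show "(x \<otimes> y, 0) = (x, 0) \<otimes>\<^bsub>?E\<^esub> (y, 0)" if "x \<in> carrier G" "y \<in> carrier G" for x y
      using c that by (simp add: floor_extension_mult[OF c, where m=0] floor_cocycle_def floor_prod_eq_one)
  qed (simp add: floor_extension_def)
  moreover have "snd \<in> hom ?E Qgroup"
    by (auto simp: hom_def floor_extension_def Qgroup_def)
  moreover have "snd ` carrier ?E = UNIV"
    by (auto simp: floor_extension_def intro!: image_eqI[where x="(\<one>, _)"])
  moreover have "kernel ?E Qgroup snd = (\<lambda>x. (x, 0)) ` carrier G"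
    by (auto simp: kernel_def floor_extension_def Qgroup_def)
  moreover have "inj_on (\<lambda>x. (x, 0 :: rat)) (carrier G)" by (auto simp: inj_on_def)
  ultimately obtain s where s: "s \<in> hom Qgroup ?E" "\<And>q. snd (s q) = q"
    using assms(1) comm_group_floor_extension[OF c] unfolding cotorsion_def by meson
  define t where "t q = fst (s q)" for q
  have st: "s q = (t q, q)" for q using s(2)[of q] by (simp add: t_def prod_eq_iff)
  have tc: "t q \<in> carrier G" for q
  proof -
    have "s q \<in> carrier ?E" using s(1) by (auto simp: hom_def Pi_def Qgroup_def)
    then show ?thesis by (simp add: st floor_extension_def)
  qed
  note Fc = floor_prod_closed[of c, OF c]
  \<comment> \<open>The first component \<open>t\<close> need not be additive by itself; adding the
    partial sum at a level that clears the denominators makes it so.\<close>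
  have hom: "t (q + r) \<otimes> floor_prod G c m (q + r) = (t q \<otimes> floor_prod G c m q) \<otimes> (t r \<otimes> floor_prod G c m r)"
    if "q * fact (Suc m) \<in> \<int>" "r * fact (Suc m) \<in> \<int>" for q r m
  proof -
    have "s (q + r) = s q \<otimes>\<^bsub>?E\<^esub> s r"
      using hom_mult[OF s(1), of q r] by (simp add: Qgroup_def)
    then have "t (q + r) = t q \<otimes> t r \<otimes> floor_cocycle G c m q r"
      using that by (simp add: st floor_extension_mult[OF c, where m=m])
    then have "t (q + r) \<otimes> floor_prod G c m (q + r) = (t q \<otimes> floor_prod G c m q) \<otimes> (t r \<otimes> floor_prod G c m r)
        \<otimes> (inv floor_prod G c m (q + r) \<otimes> floor_prod G c m (q + r))"
      using tc Fc by (simp add: floor_cocycle_def m_ac del: l_inv Units_l_inv)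
    then show ?thesis using tc Fc by simp
  qed
  have zero: "t 0 \<otimes> floor_prod G c m 0 = \<one>" for m
    using hom[of 0 m 0] tc[of 0] Fc[of m 0] by (metis Ints_0 add.right_neutral l_cancel_one m_closed mult_zero_left)
  have pow: "t (of_nat k * q) \<otimes> floor_prod G c m (of_nat k * q) = (t q \<otimes> floor_prod G c m q) [^] k"
    if "q * fact (Suc m) \<in> \<int>" for k q m
  proof (induction k)
    case 0
    then show ?case by (simp add: zero)
  next
    case (Suc k)
    have "of_nat k * q * fact (Suc m) \<in> \<int>" using that by (metis Ints_mult Ints_of_nat mult.assoc)
    then have "t (of_nat k * q + q) \<otimes> floor_prod G c m (of_nat k * q + q) = (t q \<otimes> floor_prod G c m q) [^] k \<otimes> (t q \<otimes> floor_prod G c m q)"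
      using hom[of "of_nat k * q" m q] that Suc by simp
    moreover have "of_nat (Suc k) * q = of_nat k * q + q" by (simp add: algebra_simps)
    ultimately show ?case by (simp only: nat_pow_Suc)
  qed
  define h where "h n = t (1 / fact (Suc n))" for n
  have "h n \<otimes> c n = h (Suc n) [^] (n + 2)" for n
  proof -
    \<comment> \<open>Level \<open>n+1\<close> clears \<open>?q\<close>. At that level the partial
      sum of \<open>?q\<close> vanishes (\<open>e1\<close>) and that of \<open>1/(n+1)!\<close> is
      exactly \<open>c n\<close> (\<open>e3\<close>).\<close>
    let ?q = "1 / fact (Suc (Suc n)) :: rat"
    have fact: "(fact (Suc (Suc n)) :: rat) = of_nat (n + 2) * fact (Suc n)"
      by (simp add: fact_Suc[of "Suc n"])
    have "a * (1 / (a * b)) = 1 / b" if "a \<noteq> 0" for a b :: rat using that by simp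
    moreover have "(of_nat (n + 2) :: rat) \<noteq> 0" by (simp only: of_nat_eq_0_iff)
    ultimately have q: "of_nat (n + 2) * ?q = 1 / fact (Suc n)" unfolding fact by blast
    have q': "?q * fact (Suc (Suc n)) \<in> \<int>" by simp
    have "(fact (Suc n) :: rat) < fact (Suc (Suc n))" by (rule fact_less_mono) auto
    then have e1: "floor_prod G c (Suc n) ?q = \<one>"
      by (intro floor_prod_eq_one[OF c]) (simp_all add: field_simps)
    have e2: "floor_prod G c n (1 / fact (Suc n)) = \<one>"
    \<comment> \<open>For \<open>n = 0\<close> the strict inequality fails because
      \<open>0! = 1!\<close>, but the product is then empty.\<close>
    proof (cases "n = 0")
      case False
      then have "(fact n :: rat) < fact (Suc n)" by (intro fact_less_mono) auto
      then show ?thesis by (intro floor_prod_eq_one[OF c]) (simp_all add: field_simps)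
    qed (simp add: floor_prod_def)
    have e3: "floor_prod G c (Suc n) (1 / fact (Suc n)) = c n"
      using c by (simp add: floor_prod_Suc e2)
    show ?thesis
      using pow[OF q', of "n + 2"] tc unfolding q e1 e3 by (simp add: h_def)
  qed
  then show ?thesis using that[of h] tc by (simp add: h_def)
qed

end

declare fact_Suc [simp]

section \<open>The diagram of row-finite sets\<close>

definition row_finite_sets :: "nat set set" where
  "row_finite_sets = {S. \<forall>i. finite {j. prod_encode (i, j) \<in> S}}"

text \<open>Three pairs of braces because the diagram must take values in \<open>nat set set set\<close>; the base point is \<open>{}\<close>.\<close>

definition pt :: "nat \<Rightarrow> nat set set set" where
  "pt k = {{{k}}}"

definition pts :: "nat set \<Rightarrow> nat set set set set" where
  "pts S = insert {} (pt ` S)"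

definition collapse :: "nat set \<Rightarrow> nat set \<Rightarrow> nat set set set \<Rightarrow> nat set set set" where
  "collapse t s y = (if y \<in> pts s then y else {})"

abbreviation row_lim_smash :: "('a,'m) monoid_scheme \<Rightarrow> (nat set \<Rightarrow> nat set set set \<Rightarrow> 'a) monoid" where
  "row_lim_smash A \<equiv> lim_smash_group A row_finite_sets (\<subseteq>) pts (\<lambda>_. {}) collapse"

abbreviation row_rho_image :: "('a,'m) monoid_scheme \<Rightarrow> (nat set \<Rightarrow> nat set set set \<Rightarrow> 'a) set" where
  "row_rho_image A \<equiv> rho_image A row_finite_sets (\<subseteq>) pts (\<lambda>_. {}) collapse"

text \<open>Coordinates on the limit: \<open>a\<close> gives the coefficient at the code of each
  pair, and stage \<open>t\<close> sees only the codes in \<open>t\<close>.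
  \<open>inv_into UNIV pt\<close> recovers the code from the point.\<close>

definition row_family :: "('a,'m) monoid_scheme \<Rightarrow> (nat \<Rightarrow> 'a) \<Rightarrow> nat set \<Rightarrow> nat set set set \<Rightarrow> 'a" where
  "row_family A a = (\<lambda>t\<in>row_finite_sets. \<lambda>z. if z \<in> pt ` t then a (inv_into UNIV pt z) else \<one>\<^bsub>A\<^esub>)"

section \<open>Row-finite sets and the diagram over them\<close>

lemma inj_pt: "inj pt"
  by (auto simp: inj_def pt_def)

lemma pt_simps [simp]: "pt k \<noteq> {}" "{} \<noteq> pt k" "pt k = pt l \<longleftrightarrow> k = l" "inv_into UNIV pt (pt k) = k"
  by (simp_all add: inj_eq[OF inj_pt] inv_f_f[OF inj_pt]) (simp_all add: pt_def)

lemma pt_mem_pts [simp]: "pt k \<in> pts S \<longleftrightarrow> k \<in> S"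
  by (auto simp: pts_def)

lemma empty_mem_pts [simp]: "{} \<in> pts S"
  by (simp add: pts_def)

lemma pt_mem_image [simp]: "pt k \<in> pt ` S \<longleftrightarrow> k \<in> S"
  by auto

lemma finite_imp_row_finite: "finite S \<Longrightarrow> S \<in> row_finite_sets"
proof -
  assume "finite S"
  then have "finite (Pair i -` (prod_encode -` S))" for i
    by (intro finite_vimageI inj_prod_encode) (auto simp: inj_def)
  then show ?thesis by (auto simp: row_finite_sets_def vimage_def)
qed

lemma row_finite_Un: "S \<in> row_finite_sets \<Longrightarrow> U \<in> row_finite_sets \<Longrightarrow> S \<union> U \<in> row_finite_sets"
  by (auto simp: row_finite_sets_def Collect_disj_eq)

text \<open>One point from each row. Sets of this form limit an element of the limit to finitely
  many nonzero rows.\<close>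

lemma row_finite_transversal: "range (\<lambda>i. prod_encode (i, f i)) \<in> row_finite_sets"
proof -
  have "{j. prod_encode (i, j) \<in> range (\<lambda>i. prod_encode (i, f i))} \<subseteq> {f i}" for i
    by (auto simp: prod_encode_eq)
  then show ?thesis using finite_subset by (fastforce simp: row_finite_sets_def)
qed

lemma directed_row_finite_sets: "directed_poset row_finite_sets (\<subseteq>)"
  unfolding directed_poset_def
  using finite_imp_row_finite[of "{}"] row_finite_Un
  by (auto intro!: bexI[where x="_ \<union> _"])

text \<open>Subsets of column \<open>0\<close> contain at most one point of each row, so they
  already provide continuum many row-finite sets.\<close>

lemma row_finite_sets_eqpoll: "row_finite_sets \<approx> (UNIV :: nat set set)"
proof (rule lepoll_antisym)
  show "row_finite_sets \<lesssim> (UNIV :: nat set set)" by (simp add: subset_imp_lepoll)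
  let ?f = "\<lambda>U. (\<lambda>i. prod_encode (i, 0)) ` U"
  have "inj ?f"
    by (rule injI) (auto simp: inj_image_eq_iff inj_def prod_encode_eq)
  moreover have "?f U \<in> row_finite_sets" for U
  proof -
    have "{j. prod_encode (i, j) \<in> ?f U} \<subseteq> {0}" for i by (auto simp: prod_encode_eq)
    then show ?thesis using finite_subset by (fastforce simp: row_finite_sets_def)
  qed
  ultimately show "(UNIV :: nat set set) \<lesssim> row_finite_sets"
    by (auto simp: lepoll_def intro!: exI[of _ ?f])
qed

lemma pointed_diagram_pts: "pointed_diagram row_finite_sets (\<subseteq>) pts (\<lambda>_. {}) collapse"
  by (auto simp: pointed_diagram_def collapse_def pts_def)

lemma surjective_diagram_pts: "surjective_diagram row_finite_sets (\<subseteq>) pts collapse"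
proof -
  have "collapse t s ` pts t = pts s" if "s \<subseteq> t" for s t
  proof
    show "collapse t s ` pts t \<subseteq> pts s" by (auto simp: collapse_def pts_def)
    show "pts s \<subseteq> collapse t s ` pts t"
      using that by (auto simp: collapse_def pts_def intro!: image_eqI)
  qed
  then show ?thesis by (simp add: surjective_diagram_def)
qed

section \<open>Threads: the limit of the diagram\<close>

definition pt_thread :: "nat \<Rightarrow> nat set \<Rightarrow> nat set set set" where
  "pt_thread k = (\<lambda>t\<in>row_finite_sets. if k \<in> t then pt k else {})"

lemma inj_pt_thread: "inj pt_thread"
proof (rule injI)
  fix k l assume "pt_thread k = pt_thread l"
  then have "pt_thread k {k} = pt_thread l {k}" by simp
  then show "k = l" by (auto simp: pt_thread_def finite_imp_row_finite split: if_splits)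
qed

text \<open>A compatible family other than the base point takes some value \<open>pt k\<close>;
  restricting to \<open>{k}\<close> and comparing with the sets containing \<open>k\<close> then
  fixes it everywhere.\<close>

lemma lim_set_pts:
  "lim_set row_finite_sets (\<subseteq>) pts collapse = insert (\<lambda>t\<in>row_finite_sets. {}) (range pt_thread)"
proof
  show "insert (\<lambda>t\<in>row_finite_sets. {}) (range pt_thread) \<subseteq> lim_set row_finite_sets (\<subseteq>) pts collapse"
  proof -
    have "collapse t s (pt_thread k t) = pt_thread k s"
      if "s \<in> row_finite_sets" "t \<in> row_finite_sets" "s \<subseteq> t" for k s t
      using that by (cases "k \<in> t") (auto simp: pt_thread_def collapse_def)
    moreover have "collapse t s {} = {}" for s t by (simp add: collapse_def)
    moreover have "pt_thread k \<in> Pi\<^sub>E row_finite_sets pts" for k by (auto simp: pt_thread_def)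
    ultimately have "pt_thread k \<in> lim_set row_finite_sets (\<subseteq>) pts collapse" for k
      by (simp add: lim_set_def)
    moreover have "(\<lambda>t\<in>row_finite_sets. {}) \<in> lim_set row_finite_sets (\<subseteq>) pts collapse"
      by (auto simp: lim_set_def collapse_def)
    ultimately show ?thesis by blast
  qed
  show "lim_set row_finite_sets (\<subseteq>) pts collapse \<subseteq> insert (\<lambda>t\<in>row_finite_sets. {}) (range pt_thread)"
  proof
    fix x assume "x \<in> lim_set row_finite_sets (\<subseteq>) pts collapse"
    then have x: "x \<in> Pi\<^sub>E row_finite_sets pts"
      and comp: "\<And>s t. s \<in> row_finite_sets \<Longrightarrow> t \<in> row_finite_sets \<Longrightarrow> s \<subseteq> t \<Longrightarrow> collapse t s (x t) = x s"
      by (auto simp: lim_set_def)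
    show "x \<in> insert (\<lambda>t\<in>row_finite_sets. {}) (range pt_thread)"
    proof (cases "\<exists>t\<in>row_finite_sets. x t \<noteq> {}")
      case False
      then have "x = (\<lambda>t\<in>row_finite_sets. {})"
        using x by (intro extensionalityI[of _ row_finite_sets]) (auto simp: PiE_def)
      then show ?thesis by simp
    next
      case True
      then obtain t where t: "t \<in> row_finite_sets" "x t \<noteq> {}" by blast
      then have "x t \<in> pts t" using x by auto
      then obtain k where k: "k \<in> t" "x t = pt k" using t by (auto simp: pts_def)
      have x_k: "x u = pt k" if "u \<in> row_finite_sets" "{k} \<subseteq> u" for u
      proof -
        have "x {k} = pt k"
          using comp[of "{k}" t] k t by (auto simp: finite_imp_row_finite collapse_def)
        then show ?thesis
          using comp[of "{k}" u] that by (auto simp: finite_imp_row_finite collapse_def split: if_splits)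
      qed
      have "x u = (if k \<in> u then pt k else {})" if u: "u \<in> row_finite_sets" for u
      proof -
        \<comment> \<open>\<open>u\<close> and \<open>{k}\<close> may be incomparable, so the value
          at \<open>u\<close> is read off from their join.\<close>
        have uk: "insert k u \<in> row_finite_sets"
          using row_finite_Un[OF u finite_imp_row_finite[of "{k}"]] by simp
        show ?thesis using comp[OF u uk subset_insertI] x_k[OF uk] by (simp add: collapse_def)
      qed
      then have "x = pt_thread k"
        using x by (intro ext) (simp add: pt_thread_def PiE_arb[OF x])
      then show ?thesis by simp
    qed
  qed
qed

section \<open>The limit of smash products and the image of rho in coordinates\<close>

context comm_group
begin

text \<open>Fibres of \<open>collapse\<close> over points other than the base point have at most one
  element, so no coefficients are added up and the pushforward is plain restriction.\<close>

lemma smash_map_collapse: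
  assumes u: "u \<in> smash (pts t) {} G"
  shows "smash_map G (collapse t s) {} u = (\<lambda>z. if z \<in> pt ` s then u z else \<one>)"
proof
  fix z
  show "smash_map G (collapse t s) {} u z = (if z \<in> pt ` s then u z else \<one>)"
  proof (cases "z = {}")
    case True
    then show ?thesis by (auto simp: smash_map_def)
  next
    case False
    then have "{y. u y \<noteq> \<one> \<and> collapse t s y = z} = (if z \<in> pt ` s \<and> u z \<noteq> \<one> then {z} else {})"
      using u by (auto simp: collapse_def pts_def smash_def)
    then show ?thesis using False u by (auto simp: smash_map_def smash_def finprod_insert)
  qed
qed

text \<open>Singletons are row-finite, so compatibility leaves one coefficient per code; what
  remains of the smash condition is finite support on each row-finite set.\<close>

lemma carrier_row_lim_smash:
  "carrier (row_lim_smash G) =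
     {row_family G a |a. range a \<subseteq> carrier G \<and> (\<forall>t\<in>row_finite_sets. finite {k\<in>t. a k \<noteq> \<one>})}" (is "?L = ?R")
proof
  show "?R \<subseteq> ?L"
  proof clarify
    fix a assume a: "range a \<subseteq> carrier G" and fin: "\<forall>t\<in>row_finite_sets. finite {k\<in>t. a k \<noteq> \<one>}"
    have sm: "row_family G a t \<in> smash (pts t) {} G" if "t \<in> row_finite_sets" for t
    proof -
      have "{z. row_family G a t z \<noteq> \<one>} \<subseteq> pt ` {k\<in>t. a k \<noteq> \<one>}"
        using that by (auto simp: row_family_def)
      then have "finite {z. row_family G a t z \<noteq> \<one>}"
        using fin that by (meson finite_imageI finite_subset)
      then show ?thesis using that a by (auto simp: smash_def row_family_def pts_def)
    qed
    have "smash_map G (collapse t s) {} (row_family G a t) = row_family G a s"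
      if "s \<in> row_finite_sets" "t \<in> row_finite_sets" "s \<subseteq> t" for s t
      unfolding smash_map_collapse[OF sm[OF that(2)]] using that by (auto simp: row_family_def fun_eq_iff)
    then show "row_family G a \<in> ?L"
      using sm by (auto simp: lim_smash_group_def row_family_def)
  qed
  show "?L \<subseteq> ?R"
  proof
    fix w assume "w \<in> ?L"
    then have w: "w \<in> Pi\<^sub>E row_finite_sets (\<lambda>t. smash (pts t) {} G)"
      and comp: "\<And>s t. s \<in> row_finite_sets \<Longrightarrow> t \<in> row_finite_sets \<Longrightarrow> s \<subseteq> t \<Longrightarrow>
        smash_map G (collapse t s) {} (w t) = w s"
      by (auto simp: lim_smash_group_def)
    define a where "a k = w {k} (pt k)" for k
    have sm: "w t \<in> smash (pts t) {} G" if "t \<in> row_finite_sets" for t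
      using w that by auto
    have wa: "w t (pt k) = a k" if "t \<in> row_finite_sets" "k \<in> t" for t k
      using fun_cong[OF comp[of "{k}" t], of "pt k"]
        fun_cong[OF smash_map_collapse[OF sm[OF that(1)], of "{k}"], of "pt k"] that
      by (simp add: a_def finite_imp_row_finite)
    have "w = row_family G a"
    proof
      fix t
      show "w t = row_family G a t"
      proof (cases "t \<in> row_finite_sets")
        case True
        show ?thesis
        proof
          fix z
          show "w t z = row_family G a t z"
            using wa[OF True] sm[OF True] True by (auto simp: row_family_def smash_def pts_def)
        qed
      next
        case False
        then show ?thesis using PiE_arb[OF w False] by (simp add: row_family_def)
      qed
    qed
    moreover have "range a \<subseteq> carrier G"
      using sm[OF finite_imp_row_finite] by (auto simp: a_def smash_def)
    moreover have "finite {k\<in>t. a k \<noteq> \<one>}" if "t \<in> row_finite_sets" for t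
    proof -
      have "finite (pt -` {z. w t z \<noteq> \<one>})"
        using sm[OF that] by (intro finite_vimageI inj_pt) (auto simp: smash_def)
      then show ?thesis by (rule rev_finite_subset) (use wa[OF that] in auto)
    qed
    ultimately show "w \<in> ?R" by blast
  qed
qed

text \<open>Distinct threads stay distinct wherever they are not at the base point, so
  \<open>rho\<close> only relabels coefficients. In contrast to the full limit, the support is
  finite globally.\<close>

lemma row_rho_image_eq:
  "row_rho_image G = {row_family G a |a. range a \<subseteq> carrier G \<and> finite {k. a k \<noteq> \<one>}}" (is "?L = ?R")
proof -
  let ?X = "insert (\<lambda>t\<in>row_finite_sets. {}) (range pt_thread)" and ?b = "\<lambda>t\<in>row_finite_sets. {}"
  have rho: "(\<lambda>t\<in>row_finite_sets. smash_map G (\<lambda>x. x t) {} u) = row_family G (u \<circ> pt_thread)"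
    if u: "u \<in> smash ?X ?b G" for u
  proof (intro ext)
    fix t z
    have supp: "x \<in> range pt_thread" if "u x \<noteq> \<one>" for x
    proof -
      have "\<forall>y. y \<notin> ?X - {?b} \<longrightarrow> u y = \<one>" using u unfolding smash_def mem_Collect_eq by (elim conjE)
      then have "x \<in> ?X - {?b}" using that by (rule_tac ccontr) blast
      then show ?thesis by simp
    qed
    have uc: "u x \<in> carrier G" for x using u by (simp add: smash_def)
    show "(\<lambda>t\<in>row_finite_sets. smash_map G (\<lambda>x. x t) {} u) t z = row_family G (u \<circ> pt_thread) t z"
    proof (cases "t \<in> row_finite_sets \<and> z \<noteq> {}")
      case True
      have "x = pt_thread (inv_into UNIV pt z) \<and> z \<in> pt ` t" if "u x \<noteq> \<one>" "x t = z" for x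
      proof -
        obtain k where "x = pt_thread k" using supp[OF \<open>u x \<noteq> \<one>\<close>] by blast
        moreover from this have "k \<in> t" "z = pt k"
          using True \<open>x t = z\<close> by (auto simp: pt_thread_def split: if_splits)
        ultimately show ?thesis by simp
      qed
      moreover have "pt_thread (inv_into UNIV pt z) t = z" if "z \<in> pt ` t"
        using that True by (auto simp: pt_thread_def)
      ultimately have "{x. u x \<noteq> \<one> \<and> x t = z} =
        (if z \<in> pt ` t \<and> u (pt_thread (inv_into UNIV pt z)) \<noteq> \<one> then {pt_thread (inv_into UNIV pt z)} else {})"
        by auto
      then show ?thesis using True uc by (auto simp: smash_map_def row_family_def finprod_insert)
    next
      case False
      then show ?thesis by (auto simp: smash_map_def row_family_def)
    qed
  qed
  have eq: "?L = (\<lambda>u. row_family G (u \<circ> pt_thread)) ` smash ?X ?b G"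
    unfolding rho_image_def lim_set_pts using rho by (rule image_cong[OF refl])
  show ?thesis
  proof
    show "?L \<subseteq> ?R"
      unfolding eq
    proof clarify
      fix u assume u: "u \<in> smash ?X ?b G"
      then have "finite (pt_thread -` {x. u x \<noteq> \<one>})"
        by (intro finite_vimageI inj_pt_thread) (simp add: smash_def)
      then show "\<exists>a. row_family G (u \<circ> pt_thread) = row_family G a \<and> range a \<subseteq> carrier G \<and> finite {k. a k \<noteq> \<one>}"
        using u by (intro exI[of _ "u \<circ> pt_thread"]) (auto simp: smash_def vimage_def)
    qed
    show "?R \<subseteq> ?L"
    proof clarify
      fix a :: "nat \<Rightarrow> 'a" assume a: "range a \<subseteq> carrier G" "finite {k. a k \<noteq> \<one>}"
      \<comment> \<open>Transports \<open>a\<close> along the injection \<open>pt_thread\<close>.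
        Outside its range, in particular at the base point, the value must be trivial.\<close>
      define u where "u x = (if x \<in> range pt_thread then a (inv_into UNIV pt_thread x) else \<one>)" for x
      have ua: "u \<circ> pt_thread = a" using inj_pt_thread by (auto simp: u_def)
      have "{x. u x \<noteq> \<one>} \<subseteq> pt_thread ` {k. a k \<noteq> \<one>}"
        using inj_pt_thread by (auto simp: u_def split: if_splits)
      then have "finite {x. u x \<noteq> \<one>}" using a(2) by (meson finite_imageI finite_subset)
      moreover have "pt_thread k \<noteq> ?b" for k
      proof
        assume "pt_thread k = ?b"
        then have "pt_thread k {k} = ?b {k}" by simp
        then show False by (simp add: pt_thread_def finite_imp_row_finite)
      qed
      then have "?b \<notin> range pt_thread" by (metis rangeE)
      ultimately have "u \<in> smash ?X ?b G" using a(1) by (auto simp: smash_def u_def)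
      then show "row_family G a \<in> ?L" unfolding eq using ua by (metis imageI)
    qed
  qed
qed

lemma row_family_mult:
  "row_family G a \<otimes>\<^bsub>row_lim_smash G\<^esub> row_family G b = row_family G (\<lambda>k. a k \<otimes> b k)"
  by (auto simp: lim_smash_group_def row_family_def fun_eq_iff)

lemma row_family_one: "\<one>\<^bsub>row_lim_smash G\<^esub> = row_family G (\<lambda>_. \<one>)"
  by (auto simp: lim_smash_group_def row_family_def fun_eq_iff)

lemma row_family_apply: "row_family G a {k} (pt k) = a k"
  by (simp add: row_family_def finite_imp_row_finite)

lemma mult_support_subset:
  "{k\<in>S. a k \<otimes> b k \<noteq> \<one>} \<subseteq> {k\<in>S. a k \<noteq> \<one>} \<union> {k\<in>S. b k \<noteq> \<one>}"
  by auto

section \<open>Group structure on the limit\<close>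

lemma comm_group_row_lim_smash: "comm_group (row_lim_smash G)"
proof (rule comm_groupI)
  let ?L = "row_lim_smash G"
  fix x y z assume "x \<in> carrier ?L" "y \<in> carrier ?L" "z \<in> carrier ?L"
  then obtain a b c where *: "x = row_family G a" "y = row_family G b" "z = row_family G c"
    "range a \<subseteq> carrier G" "range b \<subseteq> carrier G" "range c \<subseteq> carrier G"
    unfolding carrier_row_lim_smash by blast
  then have "a k \<in> carrier G" "b k \<in> carrier G" "c k \<in> carrier G" for k by auto
  then show "x \<otimes>\<^bsub>?L\<^esub> y \<otimes>\<^bsub>?L\<^esub> z = x \<otimes>\<^bsub>?L\<^esub> (y \<otimes>\<^bsub>?L\<^esub> z)"
    by (simp add: * row_family_mult m_assoc)
next
  let ?L = "row_lim_smash G"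
  show "\<one>\<^bsub>?L\<^esub> \<in> carrier ?L"
    unfolding carrier_row_lim_smash row_family_one by (intro CollectI exI[of _ "\<lambda>_. \<one>"]) auto
  fix x assume "x \<in> carrier ?L"
  then obtain a where a: "x = row_family G a" "range a \<subseteq> carrier G"
      "\<forall>t\<in>row_finite_sets. finite {k\<in>t. a k \<noteq> \<one>}"
    unfolding carrier_row_lim_smash by blast
  then have ac: "a k \<in> carrier G" for k by auto
  then show "\<one>\<^bsub>?L\<^esub> \<otimes>\<^bsub>?L\<^esub> x = x" by (simp add: a row_family_one row_family_mult)
  have "row_family G (\<lambda>k. inv a k) \<in> carrier ?L"
    unfolding carrier_row_lim_smash using a ac
    by (intro CollectI exI[of _ "\<lambda>k. inv a k"]) auto
  moreover have "row_family G (\<lambda>k. inv a k) \<otimes>\<^bsub>?L\<^esub> x = \<one>\<^bsub>?L\<^esub>"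
    using ac by (simp add: a row_family_one row_family_mult)
  ultimately show "\<exists>y\<in>carrier ?L. y \<otimes>\<^bsub>?L\<^esub> x = \<one>\<^bsub>?L\<^esub>" by blast
next
  let ?L = "row_lim_smash G"
  fix x y assume "x \<in> carrier ?L" "y \<in> carrier ?L"
  then obtain a b where *: "x = row_family G a" "y = row_family G b"
    "range a \<subseteq> carrier G" "range b \<subseteq> carrier G"
    "\<forall>t\<in>row_finite_sets. finite {k\<in>t. a k \<noteq> \<one>}" "\<forall>t\<in>row_finite_sets. finite {k\<in>t. b k \<noteq> \<one>}"
    unfolding carrier_row_lim_smash by blast
  then have c: "a k \<in> carrier G" "b k \<in> carrier G" for k by auto
  then show "x \<otimes>\<^bsub>?L\<^esub> y = y \<otimes>\<^bsub>?L\<^esub> x" by (simp add: * row_family_mult m_comm)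
  have "finite {k\<in>t. a k \<otimes> b k \<noteq> \<one>}" if "t \<in> row_finite_sets" for t
    using that * by (intro finite_subset[OF mult_support_subset]) auto
  then show "x \<otimes>\<^bsub>?L\<^esub> y \<in> carrier ?L"
    unfolding carrier_row_lim_smash * row_family_mult using c by blast
qed

lemma subgroup_row_rho_image: "subgroup (row_rho_image G) (row_lim_smash G)"
proof -
  let ?L = "row_lim_smash G"
  interpret L: comm_group ?L by (rule comm_group_row_lim_smash)
  show ?thesis
  proof (rule L.subgroupI)
    show "row_rho_image G \<subseteq> carrier ?L"
      unfolding row_rho_image_eq carrier_row_lim_smash by (auto intro: finite_subset)
    show "row_rho_image G \<noteq> {}"
      unfolding row_rho_image_eq by (auto intro!: exI[of _ "\<lambda>_. \<one>"])
  next
    fix x assume x: "x \<in> row_rho_image G"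
    then obtain a where a: "x = row_family G a" "range a \<subseteq> carrier G" "finite {k. a k \<noteq> \<one>}"
      unfolding row_rho_image_eq by blast
    then have ac: "a k \<in> carrier G" for k by auto
    have y: "row_family G (\<lambda>k. inv a k) \<in> row_rho_image G"
      unfolding row_rho_image_eq using a ac by (intro CollectI exI[of _ "\<lambda>k. inv a k"]) auto
    have sub: "row_rho_image G \<subseteq> carrier ?L"
      unfolding row_rho_image_eq carrier_row_lim_smash by (auto intro: finite_subset)
    have "inv\<^bsub>?L\<^esub> x = row_family G (\<lambda>k. inv a k)"
      using x y sub ac by (intro L.inv_equality) (auto simp: a row_family_one row_family_mult)
    then show "inv\<^bsub>?L\<^esub> x \<in> row_rho_image G" using y by simp
  next
    fix x y assume "x \<in> row_rho_image G" "y \<in> row_rho_image G"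
    then obtain a b where *: "x = row_family G a" "y = row_family G b"
      "range a \<subseteq> carrier G" "range b \<subseteq> carrier G" "finite {k. a k \<noteq> \<one>}" "finite {k. b k \<noteq> \<one>}"
      unfolding row_rho_image_eq by blast
    then have c: "a k \<in> carrier G" "b k \<in> carrier G" for k by auto
    have "finite {k. a k \<otimes> b k \<noteq> \<one>}"
      using * mult_support_subset[of UNIV a b] by (auto elim: finite_subset)
    then show "x \<otimes>\<^bsub>?L\<^esub> y \<in> row_rho_image G"
      unfolding row_rho_image_eq * row_family_mult using c by blast
  qed
qed

section \<open>Entries and rows of elements of the limit\<close>

lemma row_eval_hom: "(\<lambda>w. w {k} (pt k)) \<in> hom (row_lim_smash G) G"
  unfolding hom_def carrier_row_lim_smash by (auto simp: row_family_mult row_family_apply)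

text \<open>Otherwise a nontrivial entry could be chosen in every row, and the chosen positions
  would form an infinite row-finite set inside the support.\<close>

lemma row_lim_smash_trivial_row:
  assumes "w \<in> carrier (row_lim_smash G)"
  obtains i where "\<And>j. w {prod_encode (i, j)} (pt (prod_encode (i, j))) = \<one>"
proof -
  obtain a where a: "w = row_family G a" "\<And>t. t \<in> row_finite_sets \<Longrightarrow> finite {k\<in>t. a k \<noteq> \<one>}"
    using assms unfolding carrier_row_lim_smash by blast
  have "\<exists>i. \<forall>j. a (prod_encode (i, j)) = \<one>"
  proof (rule ccontr)
    assume "\<nexists>i. \<forall>j. a (prod_encode (i, j)) = \<one>"
    then obtain f where f: "\<And>i. a (prod_encode (i, f i)) \<noteq> \<one>" by metis
    let ?t = "range (\<lambda>i. prod_encode (i, f i))"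
    have "{k\<in>?t. a k \<noteq> \<one>} = ?t" using f by auto
    then have "finite ?t" using a(2)[OF row_finite_transversal[of f]] by simp
    moreover have "inj (\<lambda>i. prod_encode (i, f i))" by (auto simp: inj_def prod_encode_eq)
    ultimately show False using finite_imageD by blast
  qed
  then show ?thesis using that by (auto simp: a row_family_apply)
qed

text \<open>The support lies in row \<open>i\<close>, of which a row-finite set contains only
  finitely many points.\<close>

lemma const_row_in_lim:
  assumes "a \<in> carrier G"
  shows "row_family G (\<lambda>k. if fst (prod_decode k) = i then a else \<one>) \<in> carrier (row_lim_smash G)"
proof -
  have "finite {k\<in>t. (if fst (prod_decode k) = i then a else \<one>) \<noteq> \<one>}" if t: "t \<in> row_finite_sets" for t
  proof -
    have sub: "{k\<in>t. (if fst (prod_decode k) = i then a else \<one>) \<noteq> \<one>}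
        \<subseteq> (\<lambda>j. prod_encode (i, j)) ` {j. prod_encode (i, j) \<in> t}"
    proof
      fix k assume "k \<in> {k\<in>t. (if fst (prod_decode k) = i then a else \<one>) \<noteq> \<one>}"
      then have "k \<in> t" "k = prod_encode (i, snd (prod_decode k))"
        by (auto split: if_splits simp: prod_eq_iff[symmetric])
      then show "k \<in> (\<lambda>j. prod_encode (i, j)) ` {j. prod_encode (i, j) \<in> t}" by auto
    qed
    have "finite {j. prod_encode (i, j) \<in> t}" using t by (simp add: row_finite_sets_def)
    then show ?thesis by (rule finite_subset[OF sub finite_imageI])
  qed
  then show ?thesis unfolding carrier_row_lim_smash using assms
    by (intro CollectI exI[of _ "\<lambda>k. if fst (prod_decode k) = i then a else \<one>"]) auto
qed

text \<open>Additively, step \<open>n\<close> multiplied by \<open>(n+1)!\<close> reads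
  \<open>(n+2)! x (n+1) = (n+1)! x n\<close>, plus \<open>(n+1)! a\<close> if \<open>n = i\<close>.
  So \<open>(n+1)! x n\<close> starts at \<open>0\<close> and jumps only once, by
  \<open>(i+1)! a\<close>.\<close>

lemma recurrence_pow_fact:
  fixes x :: "nat \<Rightarrow> 'a"
  assumes x: "\<And>n. x n \<in> carrier G" and a: "a \<in> carrier G" and "x 0 = \<one>"
    and rec: "\<And>n. n < N \<Longrightarrow> x n \<otimes> (if n = i then a else \<one>) = x (Suc n) [^] (n + 2)"
    and "n \<le> N"
  shows "x n [^] (fact (Suc n) :: nat) = (if n \<le> i then \<one> else a [^] (fact (Suc i) :: nat))"
  using \<open>n \<le> N\<close>
proof (induction n)
  case 0
  then show ?case by (simp add: \<open>x 0 = \<one>\<close>)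
next
  case (Suc n)
  let ?f = "fact (Suc n) :: nat" and ?d = "if n = i then a else \<one>"
  have "(fact (Suc (Suc n)) :: nat) = (n + 2) * ?f" by simp
  then have "x (Suc n) [^] (fact (Suc (Suc n)) :: nat) = (x (Suc n) [^] (n + 2)) [^] ?f"
    using x by (simp only: nat_pow_pow)
  also have "\<dots> = (x n \<otimes> ?d) [^] ?f" using rec[of n] Suc.prems by simp
  also have "\<dots> = x n [^] ?f \<otimes> ?d [^] ?f" using x a by (intro nat_pow_distrib) auto
  also have "\<dots> = (if Suc n \<le> i then \<one> else a [^] (fact (Suc i) :: nat))"
    using Suc.IH Suc.prems a by (cases "n < i"; cases "n = i") (simp_all del: fact_Suc)
  finally show ?case .
qed

end

section \<open>The quotient is not cotorsion\<close>

theorem mainTheorem19: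
  fixes A :: "'a monoid"
  assumes "comm_group A"
    and "\<not> almost_divisible A"
  shows "\<exists>(T :: nat set set) leq (Xs :: nat set \<Rightarrow> nat set set set set) bp F.
           directed_poset T leq \<and> T \<approx> (UNIV :: nat set set) \<and>
           pointed_diagram T leq Xs bp F \<and> surjective_diagram T leq Xs F \<and>
           \<not> cotorsion (H_group A T leq Xs bp F)"
proof -
  interpret A: comm_group A by fact
  let ?L = "row_lim_smash A" and ?R = "row_rho_image A"
  interpret L: comm_group ?L by (rule A.comm_group_row_lim_smash)
  have R: "subgroup ?R ?L" by (rule A.subgroup_row_rho_image)
  interpret R: normal ?R ?L using R by (simp add: L.normal_iff_subgroup)
  let ?H = "?L Mod ?R"
  interpret H: comm_group ?H using R by (rule L.abelian_FactGroup)
  define P where "P i a m \<longleftrightarrow> a \<in> carrier A \<and> m > 0 \<and>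
      (\<forall>y\<in>carrier A. y [^]\<^bsub>A\<^esub> (fact (Suc i) * m) \<noteq> a [^]\<^bsub>A\<^esub> (fact (Suc i) :: nat))" for i m :: nat and a
  \<comment> \<open>If this failed for some \<open>i\<close>, then \<open>(i+1)! A\<close> would be
    divisible and split off with a bounded complement.\<close>
  have "\<exists>a m. P i a m" for i
  proof (rule ccontr)
    assume nP: "\<not> ?thesis"
    have "\<exists>y\<in>carrier A. y [^]\<^bsub>A\<^esub> (fact (Suc i) * m) = x [^]\<^bsub>A\<^esub> (fact (Suc i) :: nat)"
      if "x \<in> carrier A" "m > 0" for x and m :: nat
    proof (rule ccontr)
      assume "\<not> ?thesis"
      then have "P i x m" using that unfolding P_def by blast
      then show False using nP by blast
    qed
    then have "almost_divisible A"
      by (rule A.almost_divisible_if_multiples_divisible[OF fact_gt_zero])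
    then show False using assms(2) by contradiction
  qed
  then obtain a m where "\<And>i. P i (a i) (m i)" by metis
  then have a: "\<And>i. a i \<in> carrier A" and m: "\<And>i. m i > 0"
    and not_div: "\<And>i y. y \<in> carrier A \<Longrightarrow>
      y [^]\<^bsub>A\<^esub> (fact (Suc i) * m i) \<noteq> a i [^]\<^bsub>A\<^esub> (fact (Suc i) :: nat)"
    unfolding P_def by blast+
  \<comment> \<open>Which row will be usable depends on the solution of the recurrence, so every row
    receives its own obstruction; row \<open>i\<close> enters at step \<open>i\<close>.\<close>
  define c where "c i = row_family A (\<lambda>k. if fst (prod_decode k) = i then a i else \<one>\<^bsub>A\<^esub>)" for i
  have c: "c i \<in> carrier ?L" for i unfolding c_def by (rule A.const_row_in_lim[OF a])
  let ?p = "\<lambda>w. ?R #>\<^bsub>?L\<^esub> w"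
  have p: "?p \<in> hom ?L ?H" by (rule R.r_coset_hom_Mod)
  have "\<not> cotorsion ?H"
  proof
    assume cot: "cotorsion ?H"
    have pc: "?p (c n) \<in> carrier ?H" for n unfolding carrier_FactGroup using c by (rule imageI)
    obtain h where h: "\<And>n. h n \<in> carrier ?H"
      and rec: "\<And>n. h n \<otimes>\<^bsub>?H\<^esub> ?p (c n) = h (Suc n) [^]\<^bsub>?H\<^esub> (n + 2)"
      using H.cotorsion_imp_solvable_recurrence[OF cot, of "\<lambda>n. ?p (c n)", OF pc] by blast
    have "\<exists>w\<in>carrier ?L. h n = ?p w" for n
      using h[of n] unfolding carrier_FactGroup by (rule imageE) blast
    then obtain w where w: "\<And>n. w n \<in> carrier ?L" and hw: "\<And>n. h n = ?p (w n)" by metis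
    \<comment> \<open>Lifting the recurrence from \<open>?H\<close> to \<open>?L\<close> costs an
      error term in the image of \<open>rho\<close> at each step.\<close>
    have "\<exists>r\<in>?R. w n \<otimes>\<^bsub>?L\<^esub> c n = r \<otimes>\<^bsub>?L\<^esub> w (Suc n) [^]\<^bsub>?L\<^esub> (n + 2)" for n
    proof -
      have "?p (w n \<otimes>\<^bsub>?L\<^esub> c n) = h n \<otimes>\<^bsub>?H\<^esub> ?p (c n)"
        using hom_mult[OF p w c] by (simp add: hw)
      also have "\<dots> = ?p (w (Suc n) [^]\<^bsub>?L\<^esub> (n + 2))"
        unfolding rec unfolding hw by (rule hom_nat_pow[OF p w L.is_group H.is_group, symmetric])
      finally have "w n \<otimes>\<^bsub>?L\<^esub> c n \<in> ?p (w (Suc n) [^]\<^bsub>?L\<^esub> (n + 2))"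
        using L.rcos_self[OF _ R] w c by (metis L.m_closed)
      then show ?thesis by (auto simp: r_coset_def)
    qed
    then obtain r where r: "\<And>n. r n \<in> ?R"
      and rel: "\<And>n. w n \<otimes>\<^bsub>?L\<^esub> c n = r n \<otimes>\<^bsub>?L\<^esub> w (Suc n) [^]\<^bsub>?L\<^esub> (n + 2)"
      by metis
    have rL: "r n \<in> carrier ?L" for n using r R.subset by blast
    define ev where "ev k v = v {k} (pt k)" for k and v :: "nat set \<Rightarrow> nat set set set \<Rightarrow> 'a"
    have ev: "ev k \<in> hom ?L A" for k using A.row_eval_hom unfolding ev_def .
    have evc: "ev k v \<in> carrier A" if "v \<in> carrier ?L" for k v using ev[of k] that by (auto simp: hom_def)
    have ev_c: "ev (prod_encode (i, j)) (c n) = (if n = i then a i else \<one>\<^bsub>A\<^esub>)" for i j n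
      by (simp add: ev_def c_def A.row_family_apply)
    have ev_rel: "ev k (w n) \<otimes>\<^bsub>A\<^esub> ev k (c n) = ev k (r n) \<otimes>\<^bsub>A\<^esub> ev k (w (Suc n)) [^]\<^bsub>A\<^esub> (n + 2)" for k n
    proof -
      have "ev k (w n) \<otimes>\<^bsub>A\<^esub> ev k (c n) = ev k (r n \<otimes>\<^bsub>?L\<^esub> w (Suc n) [^]\<^bsub>?L\<^esub> (n + 2))"
        using hom_mult[OF ev w c] rel by metis
      also have "\<dots> = ev k (r n) \<otimes>\<^bsub>A\<^esub> ev k (w (Suc n) [^]\<^bsub>?L\<^esub> (n + 2))"
        by (rule hom_mult[OF ev rL L.nat_pow_closed[OF w]])
      finally show ?thesis
        unfolding hom_nat_pow[OF ev w L.is_group A.is_group] .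
    qed
    \<comment> \<open>The trivial row of \<open>w 0\<close> supplies the initial value
      \<open>x 0 = \<one>\<close> needed below.\<close>
    obtain i where i: "\<And>j. ev (prod_encode (i, j)) (w 0) = \<one>\<^bsub>A\<^esub>"
      using A.row_lim_smash_trivial_row[OF w] unfolding ev_def by metis
    \<comment> \<open>Beyond \<open>i\<close>, so that step \<open>i\<close> is included, and large
      enough for \<open>(i+1)! m i\<close> to divide \<open>(N+1)!\<close>.\<close>
    define N where "N = fact (Suc i) * m i + i"
    have iN: "i < N" unfolding N_def using m[of i] by simp
    \<comment> \<open>Only the first \<open>N\<close> errors matter. Each has finite support whereas
      row \<open>i\<close> is infinite, so some column \<open>j\<close> avoids them all.\<close>
    have "finite {k. ev k (r n) \<noteq> \<one>\<^bsub>A\<^esub>}" for n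
      using r[of n] unfolding A.row_rho_image_eq by (auto simp: ev_def A.row_family_apply)
    then have "finite (\<Union>n<N. {k. ev k (r n) \<noteq> \<one>\<^bsub>A\<^esub>})" by blast
    moreover have "infinite (range (\<lambda>j. prod_encode (i, j)))"
      by (intro range_inj_infinite) (auto simp: inj_def prod_encode_eq)
    ultimately have "\<not> range (\<lambda>j. prod_encode (i, j)) \<subseteq> (\<Union>n<N. {k. ev k (r n) \<noteq> \<one>\<^bsub>A\<^esub>})"
      using finite_subset by blast
    then obtain j where j: "\<And>n. n < N \<Longrightarrow> ev (prod_encode (i, j)) (r n) = \<one>\<^bsub>A\<^esub>"
      by blast
    define x where "x n = ev (prod_encode (i, j)) (w n)" for n
    have x: "x n \<in> carrier A" for n using evc[OF w] by (simp add: x_def)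
    have "x N [^]\<^bsub>A\<^esub> (fact (Suc N) :: nat) = (if N \<le> i then \<one>\<^bsub>A\<^esub> else a i [^]\<^bsub>A\<^esub> (fact (Suc i) :: nat))"
    proof (rule A.recurrence_pow_fact[OF x a])
      show "x 0 = \<one>\<^bsub>A\<^esub>" using i by (simp add: x_def)
      show "x n \<otimes>\<^bsub>A\<^esub> (if n = i then a i else \<one>\<^bsub>A\<^esub>) = x (Suc n) [^]\<^bsub>A\<^esub> (n + 2)" if "n < N" for n
        using ev_rel[of "prod_encode (i, j)" n] j[OF that] x[of "Suc n"]
        by (simp add: x_def ev_c del: A.nat_pow_Suc)
    qed simp
    then have xN: "x N [^]\<^bsub>A\<^esub> (fact (Suc N) :: nat) = a i [^]\<^bsub>A\<^esub> (fact (Suc i) :: nat)" using iN by simp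
    have "fact (Suc i) * m i dvd (fact (Suc N) :: nat)"
      using m[of i] by (intro dvd_fact) (auto simp: N_def Suc_le_eq simp del: fact_Suc)
    \<comment> \<open>The cofactor \<open>q\<close> makes \<open>x N [^] q\<close> a root of exactly
      the kind excluded by \<open>not_div\<close>.\<close>
    then obtain q where fact_N: "(fact (Suc N) :: nat) = fact (Suc i) * m i * q" by (rule dvdE)
    then have "(x N [^]\<^bsub>A\<^esub> q) [^]\<^bsub>A\<^esub> (fact (Suc i) * m i) = a i [^]\<^bsub>A\<^esub> (fact (Suc i) :: nat)"
      using xN unfolding fact_N by (simp only: A.nat_pow_pow[OF x] mult.commute)
    then show False using not_div x by blast
  qed
  then have "\<not> cotorsion (H_group A row_finite_sets (\<subseteq>) pts (\<lambda>_. {}) collapse)"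
    by (simp add: H_group_def)
  then show ?thesis
    using directed_row_finite_sets row_finite_sets_eqpoll pointed_diagram_pts surjective_diagram_pts
    by blast
qed

end
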